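(* Let $\alpha=\sqrt{a_{ij}y^iy^j}$ be a Riemannian metric and $\beta=b_iy^i$ a $1$-form on a manifold, $b:=\|\beta\|_\alpha$, and suppose $$b_{i|j}=\tau\left\{(1+k_1b^2)a_{ij}+(k_3+k_2b^2)b_ib_j\right\}$$ for some scalar function $\tau(x)$ and constants $k_1,k_2,k_3$. Let $\kappa,\rho,\nu$ be functions of $b^2$ with $1-\kappa b^2>0$ and $\nu$ nowhere zero, and define the $\beta$-deformations $$\bar\alpha=e^{\rho(b^2)}\sqrt{\alpha^2-\kappa(b^2)\beta^2},\qquad \bar\beta=\nu(b^2)\beta.$$ Then $\bar\beta$ is closed and conformal with respect to $\bar\alpha$ if and only if $$\nu=C\sqrt{1-b^2\kappa}\,e^{2\rho}\,e^{-\int\frac{k_3+k_2b^2}{2\{1+(k_1+k_3)b^2+k_2b^4\}}\,\mathrm{d}b^2}$$ for some non-zero constant $C$.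
   Context: $b_{i|j}$ denotes the covariant derivative of $\beta$ with respect to the Levi-Civita connection of $\alpha$. A $1$-form $\bar\beta=\bar b_iy^i$ is closed and conformal with respect to a Riemannian metric $\bar\alpha=\sqrt{\bar a_{ij}y^iy^j}$ if $\bar b_{i|j}=c(x)\bar a_{ij}$ for some function $c$, where the covariant derivative is taken with respect to $\bar\alpha$. The integral denotes an antiderivative in the variable $b^2$. *)

theory Defs
  imports "HOL-Analysis.Analysis"
begin

text \<open>Local (chart) setting: an open connected set U in R^n, n = CARD('n).
  Tensors are given by their components in the coordinate frame.\<close>

text \<open>Partial derivative of a scalar function along the k-th coordinate axis.\<close>
definition partial :: "'n::finite \<Rightarrow> (real^'n \<Rightarrow> real) \<Rightarrow> real^'n \<Rightarrow> real" where
  "partial k f x = deriv (\<lambda>t. f (x + t *\<^sub>R axis k 1)) 0"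

text \<open>C^m regularity of a scalar function on a set, and smoothness (C^infinity).\<close>
fun Ck_on :: "nat \<Rightarrow> (real^'n::finite) set \<Rightarrow> (real^'n \<Rightarrow> real) \<Rightarrow> bool" where
  "Ck_on 0 U f = continuous_on U f"
| "Ck_on (Suc m) U f = (f differentiable_on U \<and> (\<forall>k. Ck_on m U (partial k f)))"

definition smooth_on :: "(real^'n::finite) set \<Rightarrow> (real^'n \<Rightarrow> real) \<Rightarrow> bool" where
  "smooth_on U f \<longleftrightarrow> (\<forall>m. Ck_on m U f)"

text \<open>Smoothness of a real function of one real variable on a set.\<close>
definition smooth_real_on :: "real set \<Rightarrow> (real \<Rightarrow> real) \<Rightarrow> bool" where
  "smooth_real_on S f \<longleftrightarrow> (\<forall>m. ((deriv ^^ m) f) differentiable_on S)"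

text \<open>Riemannian metric (components a_ij) on U: symmetric, positive definite, smooth.\<close>
definition riemannian_on :: "(real^'n::finite) set \<Rightarrow> (real^'n \<Rightarrow> real^'n^'n) \<Rightarrow> bool" where
  "riemannian_on U g \<longleftrightarrow>
     (\<forall>i j. smooth_on U (\<lambda>x. g x $ i $ j)) \<and>
     (\<forall>x\<in>U. transpose (g x) = g x \<and> (\<forall>v. v \<noteq> 0 \<longrightarrow> v \<bullet> (g x *v v) > 0))"

text \<open>Christoffel symbols Gamma^k_ij of the Levi-Civita connection.\<close>
definition christoffel :: "(real^'n::finite \<Rightarrow> real^'n^'n) \<Rightarrow> real^'n \<Rightarrow> 'n \<Rightarrow> 'n \<Rightarrow> 'n \<Rightarrow> real" where
  "christoffel g x k i j =
     (1/2) * (\<Sum>l\<in>UNIV. matrix_inv (g x) $ k $ l *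
        (partial i (\<lambda>y. g y $ l $ j) x + partial j (\<lambda>y. g y $ l $ i) x
         - partial l (\<lambda>y. g y $ i $ j) x))"

text \<open>Covariant derivative b_{i|j} of the 1-form with components b_i w.r.t. g.\<close>
definition cov_deriv :: "(real^'n::finite \<Rightarrow> real^'n^'n) \<Rightarrow> (real^'n \<Rightarrow> real^'n) \<Rightarrow> real^'n \<Rightarrow> 'n \<Rightarrow> 'n \<Rightarrow> real" where
  "cov_deriv g b x i j = partial j (\<lambda>y. b y $ i) x - (\<Sum>k\<in>UNIV. christoffel g x k i j * b x $ k)"

text \<open>Squared norm b^2 = a^{ij} b_i b_j.\<close>
definition sqnorm :: "(real^'n::finite \<Rightarrow> real^'n^'n) \<Rightarrow> (real^'n \<Rightarrow> real^'n) \<Rightarrow> real^'n \<Rightarrow> real" where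
  "sqnorm g b x = b x \<bullet> (matrix_inv (g x) *v b x)"

text \<open>Closed and conformal: b_{i|j} = c(x) a_ij for some function c.\<close>
definition closed_conformal_on :: "(real^'n::finite) set \<Rightarrow> (real^'n \<Rightarrow> real^'n^'n) \<Rightarrow> (real^'n \<Rightarrow> real^'n) \<Rightarrow> bool" where
  "closed_conformal_on U g b \<longleftrightarrow>
     (\<exists>c::real^'n \<Rightarrow> real. \<forall>x\<in>U. \<forall>i j. cov_deriv g b x i j = c x * g x $ i $ j)"

text \<open>beta-deformations.\<close>
definition deformed_metric :: "(real \<Rightarrow> real) \<Rightarrow> (real \<Rightarrow> real) \<Rightarrow> (real^'n::finite \<Rightarrow> real^'n^'n) \<Rightarrow> (real^'n \<Rightarrow> real^'n) \<Rightarrow> real^'n \<Rightarrow> real^'n^'n" where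
  "deformed_metric \<rho> \<kappa> g b x =
     (\<chi> i j. exp (2 * \<rho> (sqnorm g b x)) * (g x $ i $ j - \<kappa> (sqnorm g b x) * (b x $ i) * (b x $ j)))"

definition deformed_form :: "(real \<Rightarrow> real) \<Rightarrow> (real^'n::finite \<Rightarrow> real^'n^'n) \<Rightarrow> (real^'n \<Rightarrow> real^'n) \<Rightarrow> real^'n \<Rightarrow> real^'n" where
  "deformed_form \<nu> g b x = \<nu> (sqnorm g b x) *\<^sub>R b x"

end

theory Submission
  imports Defs
begin

text \<open>
  Let b^i be \<beta> raised by \<alpha>. The hypothesis on b_i|j gives d(b^2)/dx^k = 2 b^i b_i|k
  = 2 \<tau> D b_k with D = 1 + (k1 + k3) b^2 + k2 b^4, and it shows that \<beta> is closed. Contracting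
  the Christoffel symbols of the deformed metric with b^i, those of \<alpha> drop out and one finds that
  the covariant derivative of the deformed form is c(x) times the deformed metric plus
  \<tau> E(b^2) b_i b_j, where E is linear in \<nu> and \<nu>'. Testing against a nonzero vector orthogonal
  to b (available in dimension at least 2) shows that the deformed form is closed and conformal iff
  \<tau> E b = 0. Finally, the gradient of the function \<nu> exp(F - 2\<rho>) / sqrt(1 - \<kappa> b^2) of b^2
  is a positive multiple of \<tau> E b, so on the connected set U the condition says exactly that this
  function is a constant C.
\<close>

lemma partial_eq_has_derivative:
  fixes f :: "real^'n::finite \<Rightarrow> real"
  assumes "(f has_derivative f') (at x)"
  shows "partial k f x = f' (axis k 1)"
proof -
  have lin: "linear f'"
    using assms has_derivative_linear by blast
  have "((\<lambda>t. x + t *\<^sub>R axis k 1) has_derivative (\<lambda>t. t *\<^sub>R axis k 1)) (at 0)"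
    by (auto intro!: derivative_eq_intros)
  with assms have "((\<lambda>t. f (x + t *\<^sub>R axis k 1)) has_derivative (\<lambda>t. f' (t *\<^sub>R axis k 1))) (at 0)"
    using has_derivative_compose[of "\<lambda>t::real. x + t *\<^sub>R axis k 1" _ 0 UNIV f f'] by (simp add: o_def)
  moreover have "(\<lambda>t. f' (t *\<^sub>R axis k 1)) = (*) (f' (axis k 1))"
    using lin by (simp add: linear_scale fun_eq_iff mult.commute)
  ultimately have "((\<lambda>t. f (x + t *\<^sub>R axis k 1)) has_real_derivative f' (axis k 1)) (at 0)"
    by (simp add: has_field_derivative_def)
  then show ?thesis
    unfolding partial_def by (rule DERIV_imp_deriv)
qed

lemma partial_add:
  fixes f g :: "real^'n::finite \<Rightarrow> real"
  assumes "f differentiable (at x)" "g differentiable (at x)"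
  shows "partial k (\<lambda>y. f y + g y) x = partial k f x + partial k g x"
proof -
  obtain f' g' where f: "(f has_derivative f') (at x)" and g: "(g has_derivative g') (at x)"
    using assms unfolding differentiable_def by blast
  show ?thesis
    using partial_eq_has_derivative[OF has_derivative_add[OF f g]]
      partial_eq_has_derivative[OF f] partial_eq_has_derivative[OF g] by simp
qed

lemma partial_diff:
  fixes f g :: "real^'n::finite \<Rightarrow> real"
  assumes "f differentiable (at x)" "g differentiable (at x)"
  shows "partial k (\<lambda>y. f y - g y) x = partial k f x - partial k g x"
proof -
  obtain f' g' where f: "(f has_derivative f') (at x)" and g: "(g has_derivative g') (at x)"
    using assms unfolding differentiable_def by blast
  show ?thesis
    using partial_eq_has_derivative[OF has_derivative_diff[OF f g]]
      partial_eq_has_derivative[OF f] partial_eq_has_derivative[OF g] by simp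
qed

lemma partial_mult:
  fixes f g :: "real^'n::finite \<Rightarrow> real"
  assumes "f differentiable (at x)" "g differentiable (at x)"
  shows "partial k (\<lambda>y. f y * g y) x = partial k f x * g x + f x * partial k g x"
proof -
  obtain f' g' where f: "(f has_derivative f') (at x)" and g: "(g has_derivative g') (at x)"
    using assms unfolding differentiable_def by blast
  have "((\<lambda>y. f y * g y) has_derivative (\<lambda>h. f x * g' h + f' h * g x)) (at x)"
    using has_derivative_mult[OF f g] by simp
  then show ?thesis
    using partial_eq_has_derivative[OF f] partial_eq_has_derivative[OF g]
      partial_eq_has_derivative by (metis add.commute mult.commute)
qed

lemma partial_const [simp]: "partial k (\<lambda>y::real^'n::finite. c::real) x = 0"
  using partial_eq_has_derivative[of "\<lambda>y. c" "\<lambda>h. 0" x k] by simp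

lemma partial_sum:
  fixes f :: "'i \<Rightarrow> real^'n::finite \<Rightarrow> real"
  assumes "finite S" "\<And>i. i \<in> S \<Longrightarrow> f i differentiable (at x)"
  shows "partial k (\<lambda>y. \<Sum>i\<in>S. f i y) x = (\<Sum>i\<in>S. partial k (f i) x)"
  using assms
proof (induction S rule: finite_induct)
  case (insert i S)
  then have "partial k (\<lambda>y. f i y + (\<Sum>i\<in>S. f i y)) x
      = partial k (f i) x + partial k (\<lambda>y. \<Sum>i\<in>S. f i y) x"
    by (intro partial_add) (auto intro!: differentiable_sum)
  with insert show ?case by simp
qed simp

lemma partial_compose:
  fixes f :: "real^'n::finite \<Rightarrow> real"
  assumes "f differentiable (at x)" "(h has_real_derivative h') (at (f x))"
  shows "partial k (\<lambda>y. h (f y)) x = h' * partial k f x"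
proof -
  obtain f' where f: "(f has_derivative f') (at x)"
    using assms unfolding differentiable_def by blast
  have "((\<lambda>y. h (f y)) has_derivative (\<lambda>v. h' * f' v)) (at x)"
    using has_derivative_compose[OF f, of h "(*) h'"] assms(2)
    by (simp add: has_field_derivative_def o_def)
  then show ?thesis
    using partial_eq_has_derivative[OF f] partial_eq_has_derivative by metis
qed

lemma differentiable_compose_real:
  fixes f :: "real^'n::finite \<Rightarrow> real"
  assumes "f differentiable (at x)" "(h has_real_derivative h') (at (f x))"
  shows "(\<lambda>y. h (f y)) differentiable (at x)"
proof -
  have "h differentiable (at (f x))"
    using assms(2) real_differentiable_def by blast
  then show ?thesis
    using differentiable_chain_at[OF assms(1)] by (simp add: o_def)
qed

lemma partial_cong:
  fixes f g :: "real^'n::finite \<Rightarrow> real"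
  assumes "open U" "x \<in> U" "\<And>y. y \<in> U \<Longrightarrow> f y = g y"
  shows "partial k f x = partial k g x"
proof -
  have "open ((\<lambda>t::real. x + t *\<^sub>R axis k 1) -` U)"
    by (intro open_vimage assms continuous_intros)
  moreover have "0 \<in> (\<lambda>t::real. x + t *\<^sub>R axis k 1) -` U"
    using assms by simp
  ultimately have "\<forall>\<^sub>F t in nhds 0. x + t *\<^sub>R axis k 1 \<in> U"
    using eventually_nhds by blast
  then have "\<forall>\<^sub>F t in nhds 0. f (x + t *\<^sub>R axis k 1) = g (x + t *\<^sub>R axis k 1)"
    by eventually_elim (use assms in auto)
  then show ?thesis
    unfolding partial_def by (rule deriv_cong_ev) simp
qed

lemma constant_on_if_partials_zero:
  fixes f :: "real^'n::finite \<Rightarrow> real"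
  assumes "open U" "connected U"
    and "\<And>x. x \<in> U \<Longrightarrow> f differentiable (at x)"
    and "\<And>x k. x \<in> U \<Longrightarrow> partial k f x = 0"
    and "x \<in> U" "y \<in> U"
  shows "f x = f y"
proof (rule has_derivative_zero_unique_connected[OF assms(1,2) _ assms(5,6)])
  fix z assume z: "z \<in> U"
  then obtain f' where f': "(f has_derivative f') (at z)"
    using assms(3) unfolding differentiable_def by blast
  then have lin: "linear f'"
    using has_derivative_linear by blast
  have "f' h = 0" for h
  proof -
    have "f' h = f' (\<Sum>i\<in>UNIV. h $ i *\<^sub>R axis i 1)"
      using basis_expansion[of h] by (simp add: scalar_mult_eq_scaleR)
    also have "\<dots> = (\<Sum>i\<in>UNIV. h $ i * f' (axis i 1))"
      using lin by (simp add: linear_sum linear_scale)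
    also have "\<dots> = 0"
      using assms(4)[OF z] partial_eq_has_derivative[OF f'] by simp
    finally show ?thesis .
  qed
  with f' show "(f has_derivative (\<lambda>h. 0)) (at z)"
    by (metis ext)
qed

lemma smooth_on_imp_differentiable:
  assumes "smooth_on U f" "open U" "x \<in> U"
  shows "f differentiable (at x)"
proof -
  have "Ck_on (Suc 0) U f"
    using assms(1) unfolding smooth_on_def by blast
  then show ?thesis
    using assms(2,3) differentiable_on_eq_differentiable_at by auto
qed

lemma smooth_real_on_imp_DERIV:
  assumes "smooth_real_on I f" "open I" "t \<in> I"
  shows "(f has_real_derivative deriv f t) (at t)"
proof -
  have "((deriv ^^ 0) f) differentiable_on I"
    using assms(1) unfolding smooth_real_on_def by blast
  then have "f differentiable (at t)"
    using assms(2,3) differentiable_on_eq_differentiable_at by auto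
  then show ?thesis
    using DERIV_deriv_iff_real_differentiable by blast
qed

lemma differentiable_det:
  fixes M :: "real^'n::finite \<Rightarrow> real^'m::finite^'m"
  assumes "\<And>i j. (\<lambda>y. M y $ i $ j) differentiable (at x)"
  shows "(\<lambda>y. det (M y)) differentiable (at x)"
proof -
  have "(\<lambda>y. \<Prod>i\<in>S. M y $ i $ p i) differentiable (at x)" if "finite S" for p :: "'m \<Rightarrow> 'm" and S
    using that by induction (auto intro!: differentiable_mult assms)
  then show ?thesis
    unfolding det_def by (intro differentiable_sum differentiable_mult differentiable_const) auto
qed

lemma matrix_inv_inverse:
  fixes A :: "'a::field^'n::finite^'n"
  assumes "invertible A"
  shows "A ** matrix_inv A = mat 1" "matrix_inv A ** A = mat 1"
proof -
  have "A ** matrix_inv A = mat 1 \<and> matrix_inv A ** A = mat 1"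
    using assms unfolding invertible_def matrix_inv_def by (rule someI_ex)
  then show "A ** matrix_inv A = mat 1" "matrix_inv A ** A = mat 1"
    by auto
qed

lemma invertible_iff_kernel_trivial:
  fixes A :: "'a::field^'n::finite^'n"
  shows "invertible A \<longleftrightarrow> (\<forall>v. A *v v = 0 \<longrightarrow> v = 0)"
  by (simp add: invertible_left_inverse matrix_left_invertible_ker)

lemma positive_definite_invertible:
  fixes A :: "real^'n::finite^'n"
  assumes "\<And>v. v \<noteq> 0 \<Longrightarrow> v \<bullet> (A *v v) > 0"
  shows "invertible A"
  unfolding invertible_iff_kernel_trivial using assms by fastforce

lemma matrix_vector_mult_component: "(A *v v) $ i = (\<Sum>j\<in>UNIV. A $ i $ j * v $ j)"
  by (simp add: matrix_vector_mult_def)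

lemma symmetric_matrix_inv_contract:
  fixes A :: "real^'n::finite^'n"
  assumes "transpose A = A" "invertible A" "A *v w = c"
  shows "(\<Sum>k\<in>UNIV. matrix_inv A $ k $ l * c $ k) = w $ l"
proof -
  have "transpose (matrix_inv A) ** A = mat 1"
    using assms(1) matrix_inv_inverse(1)[OF assms(2)] by (metis matrix_transpose_mul transpose_mat)
  then have "transpose (matrix_inv A) *v c = w"
    using assms(3) by (metis matrix_vector_mul_assoc matrix_vector_mul_lid)
  then have "(transpose (matrix_inv A) *v c) $ l = w $ l"
    by simp
  then show ?thesis
    by (simp add: matrix_vector_mult_def transpose_def mult.commute)
qed

text \<open>\<open>christoffel_contr g w x i j\<close> is \<open>w\<^sup>l \<Gamma>\<^sub>l\<^sub>i\<^sub>j\<close>, the Christoffel symbols of the first kind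
  of \<open>g\<close> contracted with \<open>w\<close>.\<close>

definition christoffel_contr ::
    "(real^'n::finite \<Rightarrow> real^'n^'n) \<Rightarrow> real^'n \<Rightarrow> real^'n \<Rightarrow> 'n \<Rightarrow> 'n \<Rightarrow> real" where
  "christoffel_contr g w x i j = (1/2) * (\<Sum>l\<in>UNIV. w $ l *
     (partial i (\<lambda>y. g y $ l $ j) x + partial j (\<lambda>y. g y $ l $ i) x - partial l (\<lambda>y. g y $ i $ j) x))"

lemma christoffel_contr_scaleR: "christoffel_contr g (c *\<^sub>R w) x i j = c * christoffel_contr g w x i j"
  unfolding christoffel_contr_def by (simp add: sum_distrib_left mult_ac)

lemma cov_deriv_eq_christoffel_contr:
  fixes g :: "real^'n::finite \<Rightarrow> real^'n^'n"
  assumes "transpose (g x) = g x" "invertible (g x)" "g x *v w = \<beta> x"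
  shows "cov_deriv g \<beta> x i j = partial j (\<lambda>y. \<beta> y $ i) x - christoffel_contr g w x i j"
proof -
  let ?G = "\<lambda>l. partial i (\<lambda>y. g y $ l $ j) x + partial j (\<lambda>y. g y $ l $ i) x
         - partial l (\<lambda>y. g y $ i $ j) x"
  have "(\<Sum>k\<in>UNIV. christoffel g x k i j * \<beta> x $ k)
      = (\<Sum>k\<in>UNIV. \<Sum>l\<in>UNIV. (1/2) * (matrix_inv (g x) $ k $ l * \<beta> x $ k) * ?G l)"
    unfolding christoffel_def by (simp add: sum_distrib_left sum_distrib_right algebra_simps)
  also have "\<dots> = (\<Sum>l\<in>UNIV. (1/2) * (\<Sum>k\<in>UNIV. matrix_inv (g x) $ k $ l * \<beta> x $ k) * ?G l)"
    by (subst sum.swap) (simp add: sum_distrib_left sum_distrib_right)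
  also have "\<dots> = christoffel_contr g w x i j"
    unfolding christoffel_contr_def
    by (simp add: symmetric_matrix_inv_contract[OF assms] sum_distrib_left mult.assoc)
  finally show ?thesis
    unfolding cov_deriv_def by simp
qed

lemma DERIV_deformation_weight:
  fixes \<kappa> \<rho> F :: "real \<Rightarrow> real" and k1' r1 f1 t :: real
  assumes \<kappa>: "(\<kappa> has_real_derivative k1') (at t)"
    and \<rho>: "(\<rho> has_real_derivative r1) (at t)"
    and F: "(F has_real_derivative f1) (at t)"
    and pos: "1 - \<kappa> t * t > 0"
  shows "((\<lambda>s. exp (F s - 2 * \<rho> s) / sqrt (1 - s * \<kappa> s)) has_real_derivative
     exp (F t - 2 * \<rho> t) / sqrt (1 - t * \<kappa> t) * (f1 - 2 * r1 + (t * k1' + \<kappa> t) / (2 * (1 - \<kappa> t * t)))) (at t)"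
proof -
  define S where "S = sqrt (1 - t * \<kappa> t)"
  define E where "E = exp (F t - 2 * \<rho> t)"
  have p: "0 < 1 - t * \<kappa> t"
    using pos by (simp add: mult.commute)
  then have S: "S > 0" "S * S = 1 - t * \<kappa> t"
    unfolding S_def by simp_all
  have e: "((\<lambda>s. exp (F s - 2 * \<rho> s)) has_real_derivative E * (f1 - 2 * r1)) (at t)"
    unfolding E_def using F \<rho> by (auto intro!: derivative_eq_intros)
  have r: "((\<lambda>s. sqrt (1 - s * \<kappa> s)) has_real_derivative - (t * k1' + \<kappa> t) / (2 * S)) (at t)"
    unfolding S_def using \<kappa> p by (auto intro!: derivative_eq_intros simp: divide_simps)
  have alg: "(E * (f1 - 2 * r1) * S - E * (- (t * k1' + \<kappa> t) / (2 * S))) / (S * S)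
      = E / S * (f1 - 2 * r1 + (t * k1' + \<kappa> t) / (2 * (1 - \<kappa> t * t)))"
  proof -
    have q: "1 - \<kappa> t * t = S * S"
      using S(2) by (simp add: mult.commute)
    show ?thesis
      unfolding q using S(1) by (simp add: field_simps)
  qed
  have "sqrt (1 - t * \<kappa> t) \<noteq> 0"
    using p by simp
  from DERIV_divide[OF e r this, folded S_def E_def] show ?thesis
    unfolding S_def [symmetric] E_def [symmetric] alg [symmetric] .
qed

lemma exists_orthogonal_nonzero:
  fixes v :: "real^'n::finite"
  assumes "CARD('n) \<ge> 2"
  obtains u where "u \<noteq> 0" "v \<bullet> u = 0"
proof (cases "v = 0")
  case True
  then show ?thesis
    using that[of "axis undefined 1"] by (simp add: axis_eq_0_iff)
next
  case False
  then obtain i where i: "v $ i \<noteq> 0"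
    by (auto simp: vec_eq_iff)
  have "UNIV \<noteq> {i}"
  proof
    assume "UNIV = {i}"
    then have "CARD('n) = card {i}"
      by (simp only:)
    then have "CARD('n) = 1"
      by simp
    with assms show False
      by simp
  qed
  then obtain j where j: "j \<noteq> i"
    by blast
  let ?u = "axis i (v $ j) - axis j (v $ i)"
  have "?u $ j \<noteq> 0"
    using i j by (simp add: axis_def)
  then have "?u \<noteq> 0"
    by auto
  moreover have "v \<bullet> ?u = 0"
    by (simp add: inner_diff_right inner_axis mult.commute)
  ultimately show ?thesis
    using that by blast
qed

lemma scaled_matrix_eq_rank_one_imp_zero:
  fixes A :: "real^'n::finite^'n"
  assumes "CARD('n) \<ge> 2"
    and nondeg: "\<And>u. u \<noteq> 0 \<Longrightarrow> v \<bullet> u = 0 \<Longrightarrow> u \<bullet> (A *v u) \<noteq> 0"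
    and eq: "\<And>i j. d * A $ i $ j = M * v $ i * v $ j"
  shows "M * v $ k = 0"
proof -
  obtain u where u: "u \<noteq> 0" "v \<bullet> u = 0"
    using exists_orthogonal_nonzero assms(1) by blast
  have "d * (u \<bullet> (A *v u)) = (\<Sum>i\<in>UNIV. \<Sum>j\<in>UNIV. u $ i * (d * A $ i $ j) * u $ j)"
    by (simp add: inner_vec_def matrix_vector_mult_component sum_distrib_left mult_ac)
  also have "\<dots> = M * (v \<bullet> u) * (v \<bullet> u)"
    by (simp add: eq inner_vec_def sum_distrib_left sum_distrib_right mult_ac)
  finally have "d = 0"
    using u nondeg by simp
  then have "M * v $ k * v $ k = 0"
    using eq[of k k] by simp
  then show ?thesis
    by simp
qed

locale riemannian_one_form =
  fixes U :: "(real^'n::finite) set"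
    and a :: "real^'n \<Rightarrow> real^'n^'n"
    and b :: "real^'n \<Rightarrow> real^'n"
  assumes open_U: "open U"
    and riemannian: "riemannian_on U a"
    and smooth_form: "\<forall>i. smooth_on U (\<lambda>x. b x $ i)"
begin

definition b_up :: "real^'n \<Rightarrow> real^'n" where
  "b_up y = matrix_inv (a y) *v b y"

lemma metric_transpose: "x \<in> U \<Longrightarrow> transpose (a x) = a x"
  using riemannian unfolding riemannian_on_def by auto

lemma metric_sym: "x \<in> U \<Longrightarrow> a x $ i $ j = a x $ j $ i"
proof -
  assume "x \<in> U"
  then have "transpose (a x) $ i $ j = a x $ i $ j"
    using metric_transpose by simp
  then show ?thesis
    by (simp add: transpose_def)
qed

lemma metric_positive: "x \<in> U \<Longrightarrow> v \<noteq> 0 \<Longrightarrow> v \<bullet> (a x *v v) > 0"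
  using riemannian unfolding riemannian_on_def by blast

lemma metric_invertible: "x \<in> U \<Longrightarrow> invertible (a x)"
  by (rule positive_definite_invertible) (rule metric_positive)

lemma metric_differentiable: "x \<in> U \<Longrightarrow> (\<lambda>y. a y $ i $ j) differentiable (at x)"
  using riemannian by (intro smooth_on_imp_differentiable[OF _ open_U]) (auto simp: riemannian_on_def)

lemma form_differentiable: "x \<in> U \<Longrightarrow> (\<lambda>y. b y $ i) differentiable (at x)"
  using smooth_form by (intro smooth_on_imp_differentiable[OF _ open_U]) auto

lemma partial_metric_sym: "x \<in> U \<Longrightarrow> partial k (\<lambda>y. a y $ i $ j) x = partial k (\<lambda>y. a y $ j $ i) x"
  by (rule partial_cong[OF open_U]) (simp_all add: metric_sym)

lemma metric_b_up: "y \<in> U \<Longrightarrow> a y *v b_up y = b y"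
  unfolding b_up_def using matrix_inv_inverse(1)[OF metric_invertible]
  by (simp add: matrix_vector_mul_assoc)

lemma form_eq_sum_b_up: "y \<in> U \<Longrightarrow> b y $ i = (\<Sum>j\<in>UNIV. b_up y $ j * a y $ j $ i)"
proof -
  assume y: "y \<in> U"
  have "b y $ i = (a y *v b_up y) $ i"
    using metric_b_up[OF y] by simp
  also have "\<dots> = (\<Sum>j\<in>UNIV. a y $ i $ j * b_up y $ j)"
    by (rule matrix_vector_mult_component)
  also have "\<dots> = (\<Sum>j\<in>UNIV. b_up y $ j * a y $ j $ i)"
    using metric_sym[OF y] by (simp add: mult.commute)
  finally show ?thesis .
qed

lemma sqnorm_eq_sum: "sqnorm a b y = (\<Sum>i\<in>UNIV. b_up y $ i * b y $ i)"
  unfolding sqnorm_def b_up_def by (simp add: inner_vec_def mult.commute)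

lemma b_up_differentiable: "x \<in> U \<Longrightarrow> (\<lambda>y. b_up y $ k) differentiable (at x)"
proof -
  assume x: "x \<in> U"
  let ?N = "\<lambda>y. det (\<chi> i j. if j = k then b y $ i else a y $ i $ j)"
  have "(\<lambda>y. ?N y / det (a y)) differentiable (at x)"
  proof (rule differentiable_divide)
    show "?N differentiable (at x)"
    proof (rule differentiable_det)
      fix i j
      show "(\<lambda>y. (\<chi> i j. if j = k then b y $ i else a y $ i $ j) $ i $ j) differentiable (at x)"
        using form_differentiable[OF x] metric_differentiable[OF x] by (cases "j = k") simp_all
    qed
    show "(\<lambda>y. det (a y)) differentiable (at x)"
      using metric_differentiable[OF x] by (rule differentiable_det)
    show "det (a x) \<noteq> 0"
      using metric_invertible[OF x] invertible_det_nz by blast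
  qed
  then obtain D where D: "((\<lambda>y. ?N y / det (a y)) has_derivative D) (at x)"
    unfolding differentiable_def by blast
  have cramer_b_up: "?N y / det (a y) = b_up y $ k" if "y \<in> U" for y
  proof -
    have "det (a y) \<noteq> 0"
      using metric_invertible[OF that] invertible_det_nz by blast
    then have "b_up y = (\<chi> k. det (\<chi> i j. if j = k then b y $ i else a y $ i $ j) / det (a y))"
      by (rule cramer[THEN iffD1, OF _ metric_b_up[OF that]])
    then show ?thesis
      by simp
  qed
  have "((\<lambda>y. b_up y $ k) has_derivative D) (at x)"
    by (rule has_derivative_transform_within_open[OF D open_U x cramer_b_up])
  then show ?thesis
    unfolding differentiable_def by blast
qed

lemma sqnorm_differentiable: "x \<in> U \<Longrightarrow> sqnorm a b differentiable (at x)"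
  unfolding sqnorm_eq_sum[abs_def]
  by (auto intro!: differentiable_sum differentiable_mult b_up_differentiable form_differentiable)

lemma cov_deriv_form:
  "x \<in> U \<Longrightarrow> cov_deriv a b x i j = partial j (\<lambda>y. b y $ i) x - christoffel_contr a (b_up x) x i j"
  by (rule cov_deriv_eq_christoffel_contr) (simp_all add: metric_transpose metric_invertible metric_b_up)

lemma partial_metric_b_up:
  assumes x: "x \<in> U"
  shows "(\<Sum>j\<in>UNIV. a x $ i $ j * partial k (\<lambda>y. b_up y $ j) x)
    = partial k (\<lambda>y. b y $ i) x - (\<Sum>j\<in>UNIV. partial k (\<lambda>y. a y $ i $ j) x * b_up x $ j)"
proof -
  have "partial k (\<lambda>y. b y $ i) x = partial k (\<lambda>y. \<Sum>j\<in>UNIV. a y $ i $ j * b_up y $ j) x"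
  proof (rule partial_cong[OF open_U x])
    fix y assume "y \<in> U"
    then have "b y $ i = (a y *v b_up y) $ i"
      by (simp add: metric_b_up)
    then show "b y $ i = (\<Sum>j\<in>UNIV. a y $ i $ j * b_up y $ j)"
      by (simp only: matrix_vector_mult_component)
  qed
  also have "\<dots> = (\<Sum>j\<in>UNIV. partial k (\<lambda>y. a y $ i $ j * b_up y $ j) x)"
    by (rule partial_sum) (auto intro!: differentiable_mult metric_differentiable[OF x] b_up_differentiable[OF x])
  finally show ?thesis
    by (simp add: partial_mult[OF metric_differentiable[OF x] b_up_differentiable[OF x]] sum.distrib)
qed

lemma partial_sqnorm_eq:
  assumes x: "x \<in> U"
  shows "partial k (sqnorm a b) x = 2 * (\<Sum>i\<in>UNIV. b_up x $ i * partial k (\<lambda>y. b y $ i) x)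
    - (\<Sum>i\<in>UNIV. \<Sum>j\<in>UNIV. b_up x $ i * b_up x $ j * partial k (\<lambda>y. a y $ i $ j) x)"
proof -
  define v where "v = b_up x"
  define da where "da i j = partial k (\<lambda>y. a y $ i $ j) x" for i j
  define db where "db i = partial k (\<lambda>y. b y $ i) x" for i
  define dv where "dv i = partial k (\<lambda>y. b_up y $ i) x" for i
  have "partial k (sqnorm a b) x = partial k (\<lambda>y. \<Sum>i\<in>UNIV. b_up y $ i * b y $ i) x"
    by (simp add: sqnorm_eq_sum[abs_def])
  also have "\<dots> = (\<Sum>i\<in>UNIV. dv i * b x $ i) + (\<Sum>i\<in>UNIV. v $ i * db i)"
    unfolding v_def dv_def db_def
    by (subst partial_sum)
      (auto intro!: differentiable_mult b_up_differentiable[OF x] form_differentiable[OF x]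
        simp: partial_mult[OF b_up_differentiable[OF x] form_differentiable[OF x]] sum.distrib)
  finally have ds: "partial k (sqnorm a b) x = (\<Sum>i\<in>UNIV. dv i * b x $ i) + (\<Sum>i\<in>UNIV. v $ i * db i)" .
  have "(\<Sum>i\<in>UNIV. dv i * b x $ i) = (\<Sum>i\<in>UNIV. \<Sum>j\<in>UNIV. v $ j * (a x $ j $ i * dv i))"
    unfolding form_eq_sum_b_up[OF x] v_def by (simp add: sum_distrib_left mult_ac)
  also have "\<dots> = (\<Sum>j\<in>UNIV. v $ j * (\<Sum>i\<in>UNIV. a x $ j $ i * dv i))"
    by (subst sum.swap) (simp add: sum_distrib_left)
  also have "\<dots> = (\<Sum>j\<in>UNIV. v $ j * (db j - (\<Sum>i\<in>UNIV. da j i * v $ i)))"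
    unfolding v_def da_def db_def dv_def by (simp add: partial_metric_b_up[OF x])
  finally show ?thesis
    unfolding ds v_def da_def db_def
    by (simp add: sum_subtractf right_diff_distrib sum_distrib_left mult_ac)
qed

lemma b_up_cov_deriv:
  assumes x: "x \<in> U"
  shows "(\<Sum>i\<in>UNIV. b_up x $ i * cov_deriv a b x i k)
    = (\<Sum>i\<in>UNIV. b_up x $ i * partial k (\<lambda>y. b y $ i) x)
      - (1/2) * (\<Sum>i\<in>UNIV. \<Sum>j\<in>UNIV. b_up x $ i * b_up x $ j * partial k (\<lambda>y. a y $ i $ j) x)"
proof -
  define v where "v = b_up x"
  define da where "da m i j = partial m (\<lambda>y. a y $ i $ j) x" for m i j
  have swap: "(\<Sum>i\<in>UNIV. \<Sum>l\<in>UNIV. v $ i * v $ l * da i l k)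
      = (\<Sum>i\<in>UNIV. \<Sum>l\<in>UNIV. v $ i * v $ l * da l i k)"
    by (subst sum.swap) (simp add: mult_ac)
  have sym: "da k l i = da k i l" for i l
    unfolding da_def by (rule partial_metric_sym[OF x])
  have "(\<Sum>i\<in>UNIV. v $ i * cov_deriv a b x i k)
      = (\<Sum>i\<in>UNIV. v $ i * partial k (\<lambda>y. b y $ i) x)
        - (1/2) * ((\<Sum>i\<in>UNIV. \<Sum>l\<in>UNIV. v $ i * v $ l * da i l k)
          + (\<Sum>i\<in>UNIV. \<Sum>l\<in>UNIV. v $ i * v $ l * da k l i)
          - (\<Sum>i\<in>UNIV. \<Sum>l\<in>UNIV. v $ i * v $ l * da l i k))"
    unfolding cov_deriv_form[OF x] christoffel_contr_def v_def da_def
    by (simp add: algebra_simps sum_subtractf sum.distrib sum_distrib_left)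
  also have "\<dots> = (\<Sum>i\<in>UNIV. v $ i * partial k (\<lambda>y. b y $ i) x)
        - (1/2) * (\<Sum>i\<in>UNIV. \<Sum>l\<in>UNIV. v $ i * v $ l * da k i l)"
    by (simp only: swap sym) simp
  finally show ?thesis
    unfolding v_def da_def .
qed

lemma partial_sqnorm:
  "x \<in> U \<Longrightarrow> partial k (sqnorm a b) x = 2 * (\<Sum>i\<in>UNIV. b_up x $ i * cov_deriv a b x i k)"
  by (simp add: partial_sqnorm_eq b_up_cov_deriv right_diff_distrib)

end

locale special_one_form = riemannian_one_form U a b
  for U :: "(real^'n::finite) set" and a b +
  fixes \<tau> :: "real^'n \<Rightarrow> real"
    and k1 k2 k3 :: real
  assumes cov_deriv_special: "\<forall>x\<in>U. \<forall>i j. cov_deriv a b x i j =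
               \<tau> x * ((1 + k1 * sqnorm a b x) * a x $ i $ j
                       + (k3 + k2 * sqnorm a b x) * (b x $ i) * (b x $ j))"
begin

definition D :: "real \<Rightarrow> real" where
  "D t = 1 + (k1 + k3) * t + k2 * t^2"

lemma D_eq: "D t = (1 + k1 * t) + t * (k3 + k2 * t)"
  unfolding D_def by (simp add: algebra_simps power2_eq_square)

lemma partial_sqnorm_special:
  assumes x: "x \<in> U"
  shows "partial k (sqnorm a b) x = 2 * \<tau> x * D (sqnorm a b x) * b x $ k"
proof -
  let ?v = "b_up x" and ?s = "sqnorm a b x"
  have "(\<Sum>i\<in>UNIV. ?v $ i * cov_deriv a b x i k)
     = \<tau> x * (1 + k1 * ?s) * (\<Sum>i\<in>UNIV. ?v $ i * a x $ i $ k)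
       + \<tau> x * (k3 + k2 * ?s) * b x $ k * (\<Sum>i\<in>UNIV. ?v $ i * b x $ i)"
    using cov_deriv_special x by (simp add: sum.distrib sum_distrib_left algebra_simps)
  also have "\<dots> = \<tau> x * D ?s * b x $ k"
    unfolding form_eq_sum_b_up[OF x, symmetric] sqnorm_eq_sum[symmetric] D_eq
    by (simp add: algebra_simps)
  finally show ?thesis
    using partial_sqnorm[OF x] by simp
qed

lemma christoffel_contr_sym:
  "x \<in> U \<Longrightarrow> christoffel_contr a w x i j = christoffel_contr a w x j i"
  unfolding christoffel_contr_def by (simp add: partial_metric_sym algebra_simps)

lemma special_form_closed:
  assumes x: "x \<in> U"
  shows "partial i (\<lambda>y. b y $ j) x = partial j (\<lambda>y. b y $ i) x"
proof -
  have "cov_deriv a b x j i = cov_deriv a b x i j"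
    using cov_deriv_special x metric_sym[OF x, of j i] by (simp add: mult_ac)
  then show ?thesis
    using cov_deriv_form[OF x, of i j] cov_deriv_form[OF x, of j i] christoffel_contr_sym[OF x]
    by simp
qed

lemma partial_form_special:
  "x \<in> U \<Longrightarrow> partial j (\<lambda>y. b y $ i) x = \<tau> x * ((1 + k1 * sqnorm a b x) * a x $ i $ j
       + (k3 + k2 * sqnorm a b x) * b x $ i * b x $ j) + christoffel_contr a (b_up x) x i j"
  using cov_deriv_form[of x i j] cov_deriv_special by (simp add: mult.assoc)

end

locale beta_deformation = special_one_form U a b \<tau> k1 k2 k3
  for U :: "(real^'n::finite) set" and a b \<tau> k1 k2 k3 +
  fixes \<kappa> \<rho> \<nu> :: "real \<Rightarrow> real"
    and I :: "real set"
  assumes open_I: "open I"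
    and sqnorm_in_I: "\<forall>x\<in>U. sqnorm a b x \<in> I"
    and smooth_profiles: "smooth_real_on I \<kappa>" "smooth_real_on I \<rho>" "smooth_real_on I \<nu>"
    and deformation_pos: "\<forall>x\<in>U. 1 - \<kappa> (sqnorm a b x) * sqnorm a b x > 0"
begin

abbreviation "abar \<equiv> deformed_metric \<rho> \<kappa> a b"
abbreviation "bbar \<equiv> deformed_form \<nu> a b"

lemma deformed_metric_component:
  "abar y $ i $ j = exp (2 * \<rho> (sqnorm a b y)) * (a y $ i $ j - \<kappa> (sqnorm a b y) * b y $ i * b y $ j)"
  unfolding deformed_metric_def by simp

lemma deformed_form_component: "bbar y $ i = \<nu> (sqnorm a b y) * b y $ i"
  unfolding deformed_form_def by simp

lemma deformed_metric_transpose: "x \<in> U \<Longrightarrow> transpose (abar x) = abar x"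
  by (simp add: vec_eq_iff transpose_def deformed_metric_component metric_sym mult_ac)

lemma deformed_metric_mult:
  "(abar x *v w) $ i = exp (2 * \<rho> (sqnorm a b x))
     * ((a x *v w) $ i - \<kappa> (sqnorm a b x) * b x $ i * (b x \<bullet> w))"
  by (simp add: matrix_vector_mult_component deformed_metric_component inner_vec_def
      sum_distrib_left sum_subtractf algebra_simps)

lemma deformed_metric_invertible:
  assumes x: "x \<in> U"
  shows "invertible (abar x)"
  unfolding invertible_iff_kernel_trivial
proof (intro allI impI)
  fix w assume w: "abar x *v w = 0"
  let ?s = "sqnorm a b x" and ?k = "\<kappa> (sqnorm a b x)" and ?c = "b x \<bullet> w"
  have aw: "a x *v w = (?k * ?c) *\<^sub>R b x"
    using w by (simp add: vec_eq_iff deformed_metric_mult)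
  also have "\<dots> = a x *v ((?k * ?c) *\<^sub>R b_up x)"
    by (simp add: matrix_vector_mult_scaleR metric_b_up[OF x])
  finally have "w = (?k * ?c) *\<^sub>R b_up x"
    using inj_matrix_vector_mult[OF metric_invertible[OF x]] by (simp add: inj_eq)
  then have "?c = b x \<bullet> ((?k * ?c) *\<^sub>R b_up x)"
    by (rule arg_cong)
  also have "\<dots> = ?k * ?c * ?s"
    by (simp add: sqnorm_def b_up_def)
  finally have "?c = ?k * ?c * ?s" .
  then have "?c * (1 - ?k * ?s) = 0"
    by (simp add: algebra_simps)
  moreover have "1 - ?k * ?s \<noteq> 0"
    using deformation_pos x by force
  ultimately have "?c = 0"
    by simp
  with aw have "a x *v w = 0"
    by simp
  then show "w = 0"
    using metric_invertible[OF x] invertible_iff_kernel_trivial by blast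
qed

lemma deformed_metric_raise:
  assumes x: "x \<in> U"
  shows "abar x *v ((\<nu> (sqnorm a b x) / (exp (2 * \<rho> (sqnorm a b x))
      * (1 - \<kappa> (sqnorm a b x) * sqnorm a b x))) *\<^sub>R b_up x) = bbar x"
proof -
  let ?s = "sqnorm a b x" and ?k = "\<kappa> (sqnorm a b x)" and ?p = "exp (2 * \<rho> (sqnorm a b x))"
  have "b x \<bullet> b_up x = ?s"
    unfolding sqnorm_def b_up_def ..
  moreover have "1 - ?k * ?s \<noteq> 0"
    using deformation_pos x by force
  ultimately show ?thesis
    by (simp add: vec_eq_iff deformed_metric_mult matrix_vector_mult_scaleR metric_b_up[OF x]
        deformed_form_component field_simps)
qed

lemma profiles_DERIV:
  assumes x: "x \<in> U"
  shows "(\<kappa> has_real_derivative deriv \<kappa> (sqnorm a b x)) (at (sqnorm a b x))"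
    and "(\<rho> has_real_derivative deriv \<rho> (sqnorm a b x)) (at (sqnorm a b x))"
    and "(\<nu> has_real_derivative deriv \<nu> (sqnorm a b x)) (at (sqnorm a b x))"
  using smooth_profiles sqnorm_in_I x by (simp_all add: smooth_real_on_imp_DERIV[OF _ open_I])

lemma partial_deformed_metric:
  assumes x: "x \<in> U"
  shows "partial k (\<lambda>y. abar y $ i $ j) x =
    exp (2 * \<rho> (sqnorm a b x)) * (2 * deriv \<rho> (sqnorm a b x)) * partial k (sqnorm a b) x
       * (a x $ i $ j - \<kappa> (sqnorm a b x) * b x $ i * b x $ j)
  + exp (2 * \<rho> (sqnorm a b x)) * (partial k (\<lambda>y. a y $ i $ j) x
       - ((deriv \<kappa> (sqnorm a b x) * partial k (sqnorm a b) x * b x $ i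
           + \<kappa> (sqnorm a b x) * partial k (\<lambda>y. b y $ i) x) * b x $ j
          + \<kappa> (sqnorm a b x) * b x $ i * partial k (\<lambda>y. b y $ j) x))"
proof -
  let ?s = "sqnorm a b"
  have dp: "((\<lambda>t. exp (2 * \<rho> t)) has_real_derivative
      exp (2 * \<rho> (?s x)) * (2 * deriv \<rho> (?s x))) (at (?s x))"
    using profiles_DERIV(2)[OF x] by (auto intro!: derivative_eq_intros)
  have p: "(\<lambda>y. exp (2 * \<rho> (?s y))) differentiable (at x)"
    by (rule differentiable_compose_real[OF sqnorm_differentiable[OF x] dp])
  have k: "(\<lambda>y. \<kappa> (?s y)) differentiable (at x)"
    by (rule differentiable_compose_real[OF sqnorm_differentiable[OF x] profiles_DERIV(1)[OF x]])
  note bi = form_differentiable[OF x, of i] and bj = form_differentiable[OF x, of j]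
  have kb: "(\<lambda>y. \<kappa> (?s y) * b y $ i) differentiable (at x)"
    by (rule differentiable_mult[OF k bi])
  have kbb: "(\<lambda>y. \<kappa> (?s y) * b y $ i * b y $ j) differentiable (at x)"
    by (rule differentiable_mult[OF kb bj])
  have g: "(\<lambda>y. a y $ i $ j - \<kappa> (?s y) * b y $ i * b y $ j) differentiable (at x)"
    by (rule differentiable_diff[OF metric_differentiable[OF x] kbb])
  show ?thesis
    unfolding deformed_metric_component partial_mult[OF p g]
      partial_compose[OF sqnorm_differentiable[OF x] dp]
      partial_diff[OF metric_differentiable[OF x] kbb] partial_mult[OF kb bj] partial_mult[OF k bi]
      partial_compose[OF sqnorm_differentiable[OF x] profiles_DERIV(1)[OF x]]
    by simp
qed

lemma partial_deformed_form:
  assumes x: "x \<in> U"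
  shows "partial j (\<lambda>y. bbar y $ i) x =
    deriv \<nu> (sqnorm a b x) * partial j (sqnorm a b) x * b x $ i
    + \<nu> (sqnorm a b x) * partial j (\<lambda>y. b y $ i) x"
proof -
  have n: "(\<lambda>y. \<nu> (sqnorm a b y)) differentiable (at x)"
    by (rule differentiable_compose_real[OF sqnorm_differentiable[OF x] profiles_DERIV(3)[OF x]])
  show ?thesis
    unfolding deformed_form_component partial_mult[OF n form_differentiable[OF x]]
      partial_compose[OF sqnorm_differentiable[OF x] profiles_DERIV(3)[OF x]] ..
qed

lemma christoffel_contr_deformed:
  assumes x: "x \<in> U"
  shows "christoffel_contr abar (b_up x) x i j =
    exp (2 * \<rho> (sqnorm a b x)) * (christoffel_contr a (b_up x) x i j
      + \<tau> x * D (sqnorm a b x) * (2 * deriv \<rho> (sqnorm a b x)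
          * ((2 - \<kappa> (sqnorm a b x) * sqnorm a b x) * b x $ i * b x $ j - sqnorm a b x * a x $ i $ j)
        - deriv \<kappa> (sqnorm a b x) * sqnorm a b x * b x $ i * b x $ j)
      - \<kappa> (sqnorm a b x) * sqnorm a b x * partial j (\<lambda>y. b y $ i) x)"
proof -
  define s where "s = sqnorm a b x"
  define p where "p = exp (2 * \<rho> s)"
  define v where "v = b_up x"
  define e where "e = 2 * \<tau> x * D s"
  let ?T = "\<lambda>k i j. partial k (\<lambda>y. abar y $ i $ j) x"
  let ?G = "\<lambda>l. partial i (\<lambda>y. a y $ l $ j) x + partial j (\<lambda>y. a y $ l $ i) x - partial l (\<lambda>y. a y $ i $ j) x"
  let ?c1 = "p * 2 * deriv \<rho> s * e * b x $ i"
  let ?c2 = "p * 2 * deriv \<rho> s * e * b x $ j"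
  let ?c3 = "- p * 2 * deriv \<rho> s * e * (a x $ i $ j + \<kappa> s * b x $ i * b x $ j)
      - p * deriv \<kappa> s * e * b x $ i * b x $ j - 2 * p * \<kappa> s * partial j (\<lambda>y. b y $ i) x"
  \<comment> \<open>By closedness of \<open>b\<close>, its derivatives cancel down to a multiple of \<open>\<partial>\<^sub>j b\<^sub>i\<close>.\<close>
  have summand: "v $ l * (?T i l j + ?T j l i - ?T l i j)
      = ?c1 * (v $ l * a x $ l $ j) + ?c2 * (v $ l * a x $ l $ i) + ?c3 * (v $ l * b x $ l)
        + p * (v $ l * ?G l)" for l
    unfolding partial_deformed_metric[OF x] partial_sqnorm_special[OF x]
      special_form_closed[OF x, of i l] special_form_closed[OF x, of j l]
      special_form_closed[OF x, of i j] s_def [symmetric] p_def [symmetric] e_def [symmetric]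
    by (simp add: algebra_simps)
  have "christoffel_contr abar v x i j = (1/2) * (?c1 * b x $ j + ?c2 * b x $ i + ?c3 * s
      + p * (2 * christoffel_contr a v x i j))"
  proof -
    have "b x $ m = (\<Sum>l\<in>UNIV. v $ l * a x $ l $ m)" for m
      unfolding v_def by (rule form_eq_sum_b_up[OF x])
    moreover have "s = (\<Sum>l\<in>UNIV. v $ l * b x $ l)"
      unfolding v_def s_def by (rule sqnorm_eq_sum)
    ultimately show ?thesis
      unfolding christoffel_contr_def summand
      by (simp only: sum.distrib sum_distrib_left[symmetric]) simp
  qed
  then show ?thesis
    unfolding s_def [symmetric] p_def [symmetric] v_def [symmetric] e_def
    by (simp add: algebra_simps)
qed

definition conformal_factor :: "real^'n \<Rightarrow> real" where
  "conformal_factor x = (let s = sqnorm a b x in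
     \<tau> x * \<nu> s * (1 + k1 * s + 2 * D s * deriv \<rho> s * s) / (exp (2 * \<rho> s) * (1 - \<kappa> s * s)))"

definition ode_residual :: "real \<Rightarrow> real" where
  "ode_residual t = 2 * D t * deriv \<nu> t - 4 * D t * \<nu> t * deriv \<rho> t
      + \<nu> t * D t * (t * deriv \<kappa> t + \<kappa> t) / (1 - \<kappa> t * t) + \<nu> t * (k3 + k2 * t)"

lemma cov_deriv_deformed:
  assumes x: "x \<in> U"
  shows "cov_deriv abar bbar x i j
    = conformal_factor x * abar x $ i $ j + \<tau> x * ode_residual (sqnorm a b x) * b x $ i * b x $ j"
proof -
  define s where "s = sqnorm a b x"
  define p where "p = exp (2 * \<rho> s)"
  define \<Gamma> where "\<Gamma> = christoffel_contr a (b_up x) x i j"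
  define db where "db = partial j (\<lambda>y. b y $ i) x"
  define m where "m = \<nu> s / (p * (1 - \<kappa> s * s))"
  have p: "p \<noteq> 0"
    unfolding p_def by simp
  have k: "1 - \<kappa> s * s \<noteq> 0"
    using deformation_pos x unfolding s_def by force
  have db: "db = \<tau> x * ((1 + k1 * s) * a x $ i $ j + (k3 + k2 * s) * b x $ i * b x $ j) + \<Gamma>"
    unfolding db_def \<Gamma>_def s_def by (rule partial_form_special[OF x])
  have "cov_deriv abar bbar x i j = partial j (\<lambda>y. bbar y $ i) x - christoffel_contr abar (m *\<^sub>R b_up x) x i j"
    unfolding m_def p_def s_def
    by (rule cov_deriv_eq_christoffel_contr)
      (simp_all add: x deformed_metric_transpose deformed_metric_invertible deformed_metric_raise)
  also have "\<dots> = deriv \<nu> s * (2 * \<tau> x * D s * b x $ j) * b x $ i + \<nu> s * db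
      - m * (p * (\<Gamma> + \<tau> x * D s * (2 * deriv \<rho> s
          * ((2 - \<kappa> s * s) * b x $ i * b x $ j - s * a x $ i $ j)
        - deriv \<kappa> s * s * b x $ i * b x $ j) - \<kappa> s * s * db))"
    unfolding christoffel_contr_scaleR christoffel_contr_deformed[OF x] partial_deformed_form[OF x]
      partial_sqnorm_special[OF x] s_def [symmetric] p_def [symmetric] \<Gamma>_def [symmetric] db_def [symmetric] ..
  also have "\<dots> = conformal_factor x * abar x $ i $ j + \<tau> x * ode_residual s * b x $ i * b x $ j"
  proof -
    \<comment> \<open>Writing \<nu> as m p (1 - \<kappa> s s) turns the claim into a polynomial identity.\<close>
    have \<nu>: "\<nu> s = m * p * (1 - \<kappa> s * s)"
      using p k unfolding m_def by simp
    have r1: "\<nu> s * X * Y / (1 - \<kappa> s * s) = m * p * X * Y" for X Y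
      using k unfolding \<nu> by simp
    have r2: "\<tau> x * \<nu> s * X / (p * (1 - \<kappa> s * s)) = \<tau> x * m * X" for X
      using p k unfolding \<nu> by simp
    show ?thesis
      unfolding db conformal_factor_def ode_residual_def deformed_metric_component D_eq
        s_def [symmetric] p_def [symmetric] Let_def r1 r2
      by (simp add: \<nu> algebra_simps)
  qed
  finally show ?thesis
    unfolding s_def .
qed

lemma deformed_metric_orthogonal:
  "x \<in> U \<Longrightarrow> b x \<bullet> u = 0 \<Longrightarrow> u \<bullet> (abar x *v u) = exp (2 * \<rho> (sqnorm a b x)) * (u \<bullet> (a x *v u))"
  by (simp add: inner_vec_def deformed_metric_mult sum_distrib_left algebra_simps)

lemma closed_conformal_deformed_iff:
  assumes "CARD('n) \<ge> 2"
  shows "closed_conformal_on U abar bbar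
    \<longleftrightarrow> (\<forall>x\<in>U. \<forall>k. \<tau> x * ode_residual (sqnorm a b x) * b x $ k = 0)"
proof
  assume "closed_conformal_on U abar bbar"
  then obtain c where c: "\<forall>x\<in>U. \<forall>i j. cov_deriv abar bbar x i j = c x * abar x $ i $ j"
    unfolding closed_conformal_on_def by blast
  show "\<forall>x\<in>U. \<forall>k. \<tau> x * ode_residual (sqnorm a b x) * b x $ k = 0"
  proof (intro ballI allI)
    fix x k assume x: "x \<in> U"
    show "\<tau> x * ode_residual (sqnorm a b x) * b x $ k = 0"
    proof (rule scaled_matrix_eq_rank_one_imp_zero[OF assms])
      fix u assume u: "u \<noteq> 0" "b x \<bullet> u = 0"
      then show "u \<bullet> (abar x *v u) \<noteq> 0"
        using metric_positive[OF x u(1)] by (simp add: deformed_metric_orthogonal[OF x u(2)])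
    next
      fix i j
      show "(c x - conformal_factor x) * abar x $ i $ j
          = \<tau> x * ode_residual (sqnorm a b x) * b x $ i * b x $ j"
        using c x cov_deriv_deformed[OF x, of i j] by (simp add: algebra_simps)
    qed
  qed
next
  assume "\<forall>x\<in>U. \<forall>k. \<tau> x * ode_residual (sqnorm a b x) * b x $ k = 0"
  then have "\<forall>x\<in>U. \<forall>i j. cov_deriv abar bbar x i j = conformal_factor x * abar x $ i $ j"
    by (simp add: cov_deriv_deformed)
  then show "closed_conformal_on U abar bbar"
    unfolding closed_conformal_on_def by blast
qed

end

locale beta_deformation_primitive = beta_deformation U a b \<tau> k1 k2 k3 \<kappa> \<rho> \<nu> I
  for U :: "(real^'n::finite) set" and a b \<tau> k1 k2 k3 \<kappa> \<rho> \<nu> I +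
  fixes F :: "real \<Rightarrow> real"
  assumes D_nonzero: "\<forall>t\<in>I. 1 + (k1 + k3) * t + k2 * t^2 \<noteq> 0"
    and primitive: "\<forall>t\<in>I. (F has_real_derivative
               (k3 + k2 * t) / (2 * (1 + (k1 + k3) * t + k2 * t^2))) (at t)"
begin

definition weight :: "real \<Rightarrow> real" where
  "weight t = exp (F t - 2 * \<rho> t) / sqrt (1 - t * \<kappa> t)"

definition normalized_nu :: "real \<Rightarrow> real" where
  "normalized_nu t = \<nu> t * weight t"

lemma weight_pos: "1 - \<kappa> t * t > 0 \<Longrightarrow> weight t > 0"
  unfolding weight_def by (simp add: mult.commute)

lemma normalized_nu_DERIV:
  assumes t: "t \<in> I" and pos: "1 - \<kappa> t * t > 0"
  shows "(normalized_nu has_real_derivative weight t * ode_residual t / (2 * D t)) (at t)"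
proof -
  have \<kappa>: "(\<kappa> has_real_derivative deriv \<kappa> t) (at t)"
    and \<rho>: "(\<rho> has_real_derivative deriv \<rho> t) (at t)"
    and \<nu>: "(\<nu> has_real_derivative deriv \<nu> t) (at t)"
    using smooth_profiles t by (simp_all add: smooth_real_on_imp_DERIV[OF _ open_I])
  have D: "D t \<noteq> 0"
    using D_nonzero t unfolding D_def by blast
  have F: "(F has_real_derivative (k3 + k2 * t) / (2 * D t)) (at t)"
    using primitive t unfolding D_def by blast
  have W: "(weight has_real_derivative weight t * ((k3 + k2 * t) / (2 * D t) - 2 * deriv \<rho> t
      + (t * deriv \<kappa> t + \<kappa> t) / (2 * (1 - \<kappa> t * t)))) (at t)"
    unfolding weight_def [abs_def] by (rule DERIV_deformation_weight[OF \<kappa> \<rho> F pos])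
  have "1 - \<kappa> t * t \<noteq> 0"
    using pos by simp
  with D have eq: "deriv \<nu> t * weight t + weight t * ((k3 + k2 * t) / (2 * D t) - 2 * deriv \<rho> t
      + (t * deriv \<kappa> t + \<kappa> t) / (2 * (1 - \<kappa> t * t))) * \<nu> t = weight t * ode_residual t / (2 * D t)"
    unfolding ode_residual_def by (simp add: field_simps)
  show ?thesis
    unfolding normalized_nu_def [abs_def] eq [symmetric] by (rule DERIV_mult[OF \<nu> W])
qed

lemma partial_normalized_nu:
  assumes x: "x \<in> U"
  shows "(\<lambda>y. normalized_nu (sqnorm a b y)) differentiable (at x)"
    and "partial k (\<lambda>y. normalized_nu (sqnorm a b y)) x
      = weight (sqnorm a b x) * (\<tau> x * ode_residual (sqnorm a b x) * b x $ k)"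
proof -
  let ?s = "sqnorm a b x"
  have D: "D ?s \<noteq> 0"
    using D_nonzero sqnorm_in_I x unfolding D_def by blast
  have d: "(normalized_nu has_real_derivative weight ?s * ode_residual ?s / (2 * D ?s)) (at ?s)"
    using normalized_nu_DERIV sqnorm_in_I deformation_pos x by blast
  show "(\<lambda>y. normalized_nu (sqnorm a b y)) differentiable (at x)"
    by (rule differentiable_compose_real[OF sqnorm_differentiable[OF x] d])
  show "partial k (\<lambda>y. normalized_nu (sqnorm a b y)) x
      = weight ?s * (\<tau> x * ode_residual ?s * b x $ k)"
    unfolding partial_compose[OF sqnorm_differentiable[OF x] d] partial_sqnorm_special[OF x]
    using D by simp
qed

lemma normalized_nu_constant_iff:
  assumes "connected U"
  shows "(\<forall>x\<in>U. \<forall>k. \<tau> x * ode_residual (sqnorm a b x) * b x $ k = 0)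
    \<longleftrightarrow> (\<exists>C. \<forall>x\<in>U. normalized_nu (sqnorm a b x) = C)"
proof
  assume zero: "\<forall>x\<in>U. \<forall>k. \<tau> x * ode_residual (sqnorm a b x) * b x $ k = 0"
  have "normalized_nu (sqnorm a b x) = normalized_nu (sqnorm a b y)" if "x \<in> U" "y \<in> U" for x y
    by (rule constant_on_if_partials_zero[OF open_U assms _ _ that, of "\<lambda>y. normalized_nu (sqnorm a b y)"])
      (simp_all add: partial_normalized_nu zero)
  then show "\<exists>C. \<forall>x\<in>U. normalized_nu (sqnorm a b x) = C"
    by (metis equals0I)
next
  assume "\<exists>C. \<forall>x\<in>U. normalized_nu (sqnorm a b x) = C"
  then obtain C where C: "\<forall>x\<in>U. normalized_nu (sqnorm a b x) = C"
    by blast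
  show "\<forall>x\<in>U. \<forall>k. \<tau> x * ode_residual (sqnorm a b x) * b x $ k = 0"
  proof (intro ballI allI)
    fix x k assume x: "x \<in> U"
    have "partial k (\<lambda>y. normalized_nu (sqnorm a b y)) x = partial k (\<lambda>y. C) x"
      using C by (intro partial_cong[OF open_U x]) simp
    moreover have "weight (sqnorm a b x) > 0"
      using weight_pos deformation_pos x by blast
    ultimately show "\<tau> x * ode_residual (sqnorm a b x) * b x $ k = 0"
      by (simp add: partial_normalized_nu(2)[OF x])
  qed
qed

lemma normalized_nu_eq_iff:
  assumes x: "x \<in> U"
  shows "normalized_nu (sqnorm a b x) = C \<longleftrightarrow>
    \<nu> (sqnorm a b x) = C * sqrt (1 - sqnorm a b x * \<kappa> (sqnorm a b x))
      * exp (2 * \<rho> (sqnorm a b x)) * exp (- F (sqnorm a b x))"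
proof -
  let ?s = "sqnorm a b x"
  have "sqrt (1 - ?s * \<kappa> ?s) > 0"
    using deformation_pos x by (simp add: mult.commute)
  then show ?thesis
    unfolding normalized_nu_def weight_def
    by (auto simp: exp_diff exp_minus field_simps)
qed

end

theorem proposition3p1:
  fixes U :: "(real^'n) set"
    and a :: "real^'n \<Rightarrow> real^'n^'n"
    and b :: "real^'n \<Rightarrow> real^'n"
    and \<tau> :: "real^'n \<Rightarrow> real"
    and k1 k2 k3 :: real
    and \<kappa> \<rho> \<nu> F :: "real \<Rightarrow> real"
    and I :: "real set"
  assumes dim: "CARD('n) \<ge> 2"
    and U: "open U" "connected U" "U \<noteq> {}"
    and a: "riemannian_on U a"
    and b_smooth: "\<forall>i. smooth_on U (\<lambda>x. b x $ i)"
    and bij: "\<forall>x\<in>U. \<forall>i j. cov_deriv a b x i j =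
               \<tau> x * ((1 + k1 * sqnorm a b x) * a x $ i $ j
                       + (k3 + k2 * sqnorm a b x) * (b x $ i) * (b x $ j))"
    and I: "open I" "is_interval I" "\<forall>x\<in>U. sqnorm a b x \<in> I"
    and fun_smooth: "smooth_real_on I \<kappa>" "smooth_real_on I \<rho>" "smooth_real_on I \<nu>"
    and pos: "\<forall>x\<in>U. 1 - \<kappa> (sqnorm a b x) * sqnorm a b x > 0"
    and nz: "\<forall>x\<in>U. \<nu> (sqnorm a b x) \<noteq> 0"
    and den: "\<forall>t\<in>I. 1 + (k1 + k3) * t + k2 * t^2 \<noteq> 0"
    and F: "\<forall>t\<in>I. (F has_real_derivative
               (k3 + k2 * t) / (2 * (1 + (k1 + k3) * t + k2 * t^2))) (at t)"
  shows "closed_conformal_on U (deformed_metric \<rho> \<kappa> a b) (deformed_form \<nu> a b)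
     \<longleftrightarrow> (\<exists>C::real. C \<noteq> 0 \<and> (\<forall>x\<in>U.
            \<nu> (sqnorm a b x) = C * sqrt (1 - sqnorm a b x * \<kappa> (sqnorm a b x))
                 * exp (2 * \<rho> (sqnorm a b x)) * exp (- F (sqnorm a b x))))"
proof -
  interpret beta_deformation_primitive U a b \<tau> k1 k2 k3 \<kappa> \<rho> \<nu> I F
    using U(1) a b_smooth bij I(1,3) fun_smooth pos den F by unfold_locales
  have "closed_conformal_on U abar bbar
      \<longleftrightarrow> (\<forall>x\<in>U. \<forall>k. \<tau> x * ode_residual (sqnorm a b x) * b x $ k = 0)"
    by (rule closed_conformal_deformed_iff[OF dim])
  also have "\<dots> \<longleftrightarrow> (\<exists>C. \<forall>x\<in>U. normalized_nu (sqnorm a b x) = C)"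
    by (rule normalized_nu_constant_iff[OF U(2)])
  also have "\<dots> \<longleftrightarrow> (\<exists>C. C \<noteq> 0 \<and> (\<forall>x\<in>U. normalized_nu (sqnorm a b x) = C))"
  proof -
    obtain x where x: "x \<in> U"
      using U(3) by blast
    have "weight (sqnorm a b x) > 0"
      using weight_pos pos x by blast
    then have "normalized_nu (sqnorm a b x) \<noteq> 0"
      using nz x unfolding normalized_nu_def by simp
    then show ?thesis
      using x by metis
  qed
  also have "\<dots> \<longleftrightarrow> (\<exists>C. C \<noteq> 0 \<and> (\<forall>x\<in>U. \<nu> (sqnorm a b x) = C * sqrt (1 - sqnorm a b x * \<kappa> (sqnorm a b x))
                 * exp (2 * \<rho> (sqnorm a b x)) * exp (- F (sqnorm a b x))))"
    using normalized_nu_eq_iff by (intro ex_cong1 conj_cong refl ball_cong) simp_all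
  finally show ?thesis .
qed

end
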